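(* Let $n\geq 2$, $r\geq 1$ be integers and let $d=\gcd(n,r)$, $N=n/d$. Then $\mathcal{H}(r,n,r)^{\mathrm{ab}}\cong\mathbb{Z}_N^{d-1}\oplus\mathbb{Z}^d$.
   Context: For an element $w=w(x_0,\dots,x_{n-1})$ of the free group on $x_0,\dots,x_{n-1}$, the cyclically presented group $G_n(w)$ is the group with presentation $\langle x_0,\dots,x_{n-1}\mid w(x_i,x_{i+1},\dots,x_{i+n-1})\ (0\le i<n)\rangle$, subscripts taken mod $n$. For $r,s,n\ge 1$, the generalized Fibonacci group is $\mathcal{H}(r,n,s)=G_n(w)$ with $w=x_0x_1\cdots x_{r-1}(x_rx_{r+1}\cdots x_{r+s-1})^{-1}$ (subscripts mod $n$). $G^{\mathrm{ab}}$ denotes the abelianization of $G$, and $\mathbb{Z}_N=\mathbb{Z}/N\mathbb{Z}$. *)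

theory Defs
  imports "HOL-Algebra.Product_Groups"
begin

section \<open>Free groups\<close>

text \<open>
  The letter \<open>(a, True)\<close> stands for the generator \<open>a\<close> and \<open>(a, False)\<close> for its formal inverse.
  The free group on \<open>X\<close> is realised on the set of reduced words.
\<close>

type_synonym 'a word = "('a \<times> bool) list"

definition inv_letter :: "'a \<times> bool \<Rightarrow> 'a \<times> bool" where
  "inv_letter l = (fst l, \<not> snd l)"

definition reduced :: "'a word \<Rightarrow> bool" where
  "reduced w \<longleftrightarrow> successively (\<lambda>l m. m \<noteq> inv_letter l) w"

definition cancel_cons :: "'a \<times> bool \<Rightarrow> 'a word \<Rightarrow> 'a word" where
  "cancel_cons l w = (case w of [] \<Rightarrow> [l] | m # v \<Rightarrow> if m = inv_letter l then v else l # w)"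

definition reduce :: "'a word \<Rightarrow> 'a word" where
  "reduce w = foldr cancel_cons w []"

definition free_group :: "'a set \<Rightarrow> 'a word monoid" where
  "free_group X =
     \<lparr>carrier = {w. reduced w \<and> set w \<subseteq> X \<times> UNIV},
      monoid.mult = (\<lambda>u v. reduce (u @ v)),
      one = []\<rparr>"

definition free_gen :: "'a \<Rightarrow> 'a word" where
  "free_gen a = [(a, True)]"

text \<open>The element \<open>w(f)\<close> of \<open>G\<close> obtained by substituting \<open>f a\<close> for every generator \<open>a\<close> in \<open>w\<close>.\<close>

definition subst_word :: "('g, 'm) monoid_scheme \<Rightarrow> ('a \<Rightarrow> 'g) \<Rightarrow> 'a word \<Rightarrow> 'g" where
  "subst_word G f w =
     foldr (\<lambda>(a, b) g. (if b then f a else inv\<^bsub>G\<^esub> (f a)) \<otimes>\<^bsub>G\<^esub> g) w \<one>\<^bsub>G\<^esub>"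

lemma inv_letter_inv_letter [simp]: "inv_letter (inv_letter l) = l"
  by (simp add: inv_letter_def)

lemma fst_inv_letter [simp]: "fst (inv_letter l) = fst l"
  by (simp add: inv_letter_def)

lemma reduced_Nil [simp]: "reduced []"
  by (simp add: reduced_def)

lemma reduced_ConsD: "reduced (l # w) \<Longrightarrow> reduced w"
  by (auto simp: reduced_def successively_Cons)

lemma reduced_cancel_cons: "reduced w \<Longrightarrow> reduced (cancel_cons l w)"
  by (cases w) (auto simp: cancel_cons_def reduced_def successively_Cons)

lemma cancel_cons_reduced: "reduced (l # w) \<Longrightarrow> cancel_cons l w = l # w"
  by (cases w) (auto simp: cancel_cons_def reduced_def)

lemma cancel_cons_inverse: "reduced v \<Longrightarrow> cancel_cons (inv_letter l) (cancel_cons l v) = v"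
  by (cases v) (auto simp: cancel_cons_def reduced_def successively_Cons split: list.splits)

lemma cancel_cons_inverse': "reduced v \<Longrightarrow> cancel_cons l (cancel_cons (inv_letter l) v) = v"
  using cancel_cons_inverse[of v "inv_letter l"] by simp

lemma reduced_foldr: "reduced v \<Longrightarrow> reduced (foldr cancel_cons u v)"
  by (induction u) (auto intro: reduced_cancel_cons)

lemma reduced_reduce: "reduced (reduce w)"
  by (simp add: reduce_def reduced_foldr)

lemma reduce_reduced: "reduced w \<Longrightarrow> reduce w = w"
proof (induction w)
  case (Cons l w)
  then show ?case
    using reduced_ConsD[OF Cons.prems] cancel_cons_reduced[OF Cons.prems] by (simp add: reduce_def)
qed (simp add: reduce_def)

lemma foldr_cancel_cons:
  "reduced v \<Longrightarrow> foldr cancel_cons (cancel_cons l w) v = cancel_cons l (foldr cancel_cons w v)"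
proof (cases w)
  case Nil
  then show ?thesis by (simp add: cancel_cons_def[of l "[]"])
next
  case (Cons m u)
  assume "reduced v"
  then show ?thesis
    by (cases "m = inv_letter l")
      (simp_all add: Cons cancel_cons_def[of l "x # u" for x] cancel_cons_inverse' reduced_foldr)
qed

lemma foldr_reduce:
  "reduced v \<Longrightarrow> foldr cancel_cons (reduce w) v = foldr cancel_cons w v"
  by (induction w) (auto simp: reduce_def foldr_cancel_cons)

lemma reduce_append: "reduce (u @ v) = foldr cancel_cons u (reduce v)"
  by (simp add: reduce_def)

lemma reduce_append_left: "reduce (reduce u @ v) = reduce (u @ v)"
  by (simp add: reduce_append foldr_reduce reduced_reduce)

lemma reduce_append_right: "reduce (u @ reduce v) = reduce (u @ v)"
  by (simp add: reduce_append reduce_reduced reduced_reduce)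

lemma set_cancel_cons: "set (cancel_cons l w) \<subseteq> insert l (set w)"
  by (auto simp: cancel_cons_def split: list.splits if_splits)

lemma set_reduce: "set (reduce w) \<subseteq> set w"
  by (induction w) (use set_cancel_cons in \<open>fastforce simp: reduce_def\<close>)+

lemma reduce_inverse: "reduce (rev (map inv_letter w) @ w) = []"
proof (induction w)
  case (Cons l w)
  have "reduce (rev (map inv_letter (l # w)) @ (l # w)) =
        foldr cancel_cons (rev (map inv_letter w))
          (cancel_cons (inv_letter l) (cancel_cons l (reduce w)))"
    by (simp add: reduce_def)
  also have "\<dots> = reduce (rev (map inv_letter w) @ w)"
    by (simp add: cancel_cons_inverse reduced_reduce reduce_append)
  finally show ?case using Cons.IH by simp
qed (simp add: reduce_def)

lemma group_free_group: "group (free_group X)"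
proof (rule groupI)
  fix u v assume "u \<in> carrier (free_group X)" "v \<in> carrier (free_group X)"
  then show "u \<otimes>\<^bsub>free_group X\<^esub> v \<in> carrier (free_group X)"
    using set_reduce[of "u @ v"] by (auto simp: free_group_def reduced_reduce)
next
  fix u assume u: "u \<in> carrier (free_group X)"
  let ?v = "reduce (rev (map inv_letter u))"
  have "?v \<in> carrier (free_group X)"
    using u set_reduce[of "rev (map inv_letter u)"]
    by (fastforce simp: free_group_def reduced_reduce inv_letter_def)
  moreover have "?v \<otimes>\<^bsub>free_group X\<^esub> u = \<one>\<^bsub>free_group X\<^esub>"
    by (simp add: free_group_def reduce_append_left reduce_inverse)
  ultimately show "\<exists>v\<in>carrier (free_group X). v \<otimes>\<^bsub>free_group X\<^esub> u = \<one>\<^bsub>free_group X\<^esub>"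
    by blast
qed (auto simp: free_group_def reduce_reduced reduce_append_left reduce_append_right)

lemma free_gen_closed: "a \<in> X \<Longrightarrow> free_gen a \<in> carrier (free_group X)"
  by (simp add: free_gen_def free_group_def reduced_def)

lemma subst_word_closed:
  assumes "group G" "f \<in> X \<rightarrow> carrier G" "set w \<subseteq> X \<times> UNIV"
  shows "subst_word G f w \<in> carrier G"
proof -
  interpret group G by fact
  show ?thesis using assms(2,3)
    by (induction w) (auto simp: subst_word_def Pi_iff)
qed

lemma subst_word_append:
  assumes "group G" "f \<in> X \<rightarrow> carrier G" "set u \<subseteq> X \<times> UNIV" "set v \<subseteq> X \<times> UNIV"
  shows "subst_word G f (u @ v) = subst_word G f u \<otimes>\<^bsub>G\<^esub> subst_word G f v"
  using assms(3)
proof (induction u)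
  case Nil
  interpret group G by fact
  show ?case using subst_word_closed[OF assms(1,2,4)] by (simp add: subst_word_def)
next
  case (Cons l u)
  interpret group G by fact
  have c: "subst_word G f u \<in> carrier G" "subst_word G f v \<in> carrier G"
    using subst_word_closed[OF assms(1,2)] Cons.prems assms(4) by auto
  obtain a b where l: "l = (a, b)" by (cases l)
  have "f a \<in> carrier G" using assms(2) Cons.prems l by auto
  then have "\<And>x y. x \<in> carrier G \<Longrightarrow> y \<in> carrier G \<Longrightarrow>
      (if b then f a else inv\<^bsub>G\<^esub> (f a)) \<otimes>\<^bsub>G\<^esub> (x \<otimes>\<^bsub>G\<^esub> y) =
      (if b then f a else inv\<^bsub>G\<^esub> (f a)) \<otimes>\<^bsub>G\<^esub> x \<otimes>\<^bsub>G\<^esub> y"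
    by (simp add: m_assoc)
  with Cons c show ?case by (auto simp: subst_word_def l)
qed

lemma subst_word_cancel_cons:
  assumes "group G" "f \<in> X \<rightarrow> carrier G" "set (l # w) \<subseteq> X \<times> UNIV"
  shows "subst_word G f (cancel_cons l w) = subst_word G f (l # w)"
proof (cases "\<exists>v. w = inv_letter l # v")
  case True
  then obtain v where w: "w = inv_letter l # v" by blast
  interpret group G by fact
  obtain a b where l: "l = (a, b)" by (cases l)
  have "f a \<in> carrier G" "subst_word G f v \<in> carrier G"
    using subst_word_closed[OF assms(1,2)] assms w l by auto
  then show ?thesis
    by (auto simp: w l subst_word_def cancel_cons_def inv_letter_def m_assoc[symmetric])
next
  case False
  then show ?thesis by (auto simp: cancel_cons_def split: list.splits)
qed

lemma subst_word_reduce: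
  assumes "group G" "f \<in> X \<rightarrow> carrier G" "set w \<subseteq> X \<times> UNIV"
  shows "subst_word G f (reduce w) = subst_word G f w"
  using assms(3)
proof (induction w)
  case (Cons l w)
  have "set (l # reduce w) \<subseteq> X \<times> UNIV" using Cons.prems set_reduce[of w] by auto
  from subst_word_cancel_cons[OF assms(1,2) this] Cons show ?case
    by (simp add: reduce_def) (simp add: subst_word_def)
qed (simp add: reduce_def)

text \<open>Existence part of the universal property of the free group.\<close>

lemma subst_word_hom:
  assumes "group G" "f \<in> X \<rightarrow> carrier G"
  shows "subst_word G f \<in> hom (free_group X) G"
  by (rule homI)
    (auto simp: free_group_def subst_word_closed[OF assms] subst_word_reduce[OF assms]
      subst_word_append[OF assms])

lemma subst_word_free_gen:
  assumes "group G" "f a \<in> carrier G"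
  shows "subst_word G f (free_gen a) = f a"
proof -
  interpret group G by fact
  show ?thesis using assms(2) by (simp add: subst_word_def free_gen_def)
qed


section \<open>Presentations\<close>

definition normal_closure :: "('a, 'm) monoid_scheme \<Rightarrow> 'a set \<Rightarrow> 'a set" where
  "normal_closure G R = \<Inter> {K. K \<lhd> G \<and> R \<subseteq> K}"

lemma normal_closure_normal:
  assumes "group G" "R \<subseteq> carrier G"
  shows "normal_closure G R \<lhd> G"
proof -
  interpret group G by fact
  have "carrier G \<in> {K. K \<lhd> G \<and> R \<subseteq> K}" using assms(2) normal_self by simp
  then have "subgroup (normal_closure G R) G"
    unfolding normal_closure_def by (intro subgroups_Inter) (auto intro: normal_imp_subgroup)
  then show ?thesis
    by (rule normal_invI) (auto simp: normal_closure_def intro: normal.inv_op_closed2)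
qed

definition presented_group :: "'a set \<Rightarrow> 'a word set \<Rightarrow> 'a word set monoid" where
  "presented_group X R = free_group X Mod normal_closure (free_group X) R"

definition abelianization :: "('a, 'm) monoid_scheme \<Rightarrow> 'a set monoid" where
  "abelianization G = G Mod derived G (carrier G)"


section \<open>Cyclically presented groups\<close>

definition cyclically_presented_group :: "nat \<Rightarrow> nat word \<Rightarrow> nat word set monoid" where
  "cyclically_presented_group n w =
     presented_group {..<n}
       ((\<lambda>i. subst_word (free_group {..<n}) (\<lambda>j. free_gen ((i + j) mod n)) w) ` {..<n})"

definition gen_product :: "nat \<Rightarrow> nat list \<Rightarrow> nat word" where
  "gen_product n js =
     foldr (\<lambda>j g. free_gen (j mod n) \<otimes>\<^bsub>free_group {..<n}\<^esub> g) js \<one>\<^bsub>free_group {..<n}\<^esub>"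

definition fibonacci_word :: "nat \<Rightarrow> nat \<Rightarrow> nat \<Rightarrow> nat word" where
  "fibonacci_word r n s =
     gen_product n [0..<r] \<otimes>\<^bsub>free_group {..<n}\<^esub>
       inv\<^bsub>free_group {..<n}\<^esub> (gen_product n [r..<r + s])"

definition gen_fibonacci_group :: "nat \<Rightarrow> nat \<Rightarrow> nat \<Rightarrow> nat word set monoid" where
  "gen_fibonacci_group r n s = cyclically_presented_group n (fibonacci_word r n s)"

lemma gen_product_closed: "n > 0 \<Longrightarrow> gen_product n js \<in> carrier (free_group {..<n})"
proof (induction js)
  case Nil
  then show ?case by (simp add: gen_product_def group_free_group group.is_monoid)
next
  case (Cons j js)
  interpret F: group "free_group {..<n}" by (rule group_free_group)
  show ?case using Cons F.m_closed[OF free_gen_closed[of "j mod n" "{..<n}"], of "gen_product n js"]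
    by (simp add: gen_product_def)
qed

lemma fibonacci_word_closed: "n > 0 \<Longrightarrow> fibonacci_word r n s \<in> carrier (free_group {..<n})"
proof -
  assume "n > 0"
  interpret F: group "free_group {..<n}" by (rule group_free_group)
  show ?thesis
    using gen_product_closed[OF \<open>n > 0\<close>] by (simp add: fibonacci_word_def)
qed

lemma group_cyclically_presented_group:
  assumes "n > 0" "w \<in> carrier (free_group {..<n})"
  shows "group (cyclically_presented_group n w)"
proof -
  have "subst_word (free_group {..<n}) (\<lambda>j. free_gen ((i + j) mod n)) w \<in> carrier (free_group {..<n})"
    for i
  proof (rule subst_word_closed[OF group_free_group])
    show "(\<lambda>j. free_gen ((i + j) mod n)) \<in> {..<n} \<rightarrow> carrier (free_group {..<n})"
      using assms(1) by (auto intro: free_gen_closed)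
    show "set w \<subseteq> {..<n} \<times> UNIV"
      using assms(2) by (simp add: free_group_def)
  qed
  then show ?thesis
    unfolding cyclically_presented_group_def presented_group_def
    by (intro normal.factorgroup_is_group normal_closure_normal group_free_group) auto
qed

lemma group_gen_fibonacci_group: "n > 0 \<Longrightarrow> group (gen_fibonacci_group r n s)"
  unfolding gen_fibonacci_group_def
  by (intro group_cyclically_presented_group fibonacci_word_closed)

end

theory Submission
  imports Defs "HOL-Algebra.FiniteProduct"
begin

text \<open>
  Write the generators of the abelianized group as an \<open>n\<close>-periodic sequence \<open>x\<^sub>i\<close> and put
  \<open>P(i, m) = x\<^sub>i \<cdots> x\<^bsub>i+m-1\<^esub>\<close>. The relations say \<open>P(i, r) = P(i + r, r)\<close>, so \<open>P(_, r)\<close> has the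
  periods \<open>n\<close> and \<open>r\<close>, hence \<open>d\<close>. Comparing the two splittings of \<open>P(i, r + d)\<close> shows that
  \<open>P(_, d)\<close> has period \<open>r\<close>, hence again \<open>d\<close>. Since \<open>z\<^sub>i = x\<^bsub>i+d\<^esub> / x\<^sub>i = P(i + 1, d) / P(i, d)\<close>,
  the sequence \<open>z\<close> is \<open>d\<close>-periodic with product \<open>1\<close> over a period, \<open>x\<^bsub>i+kd\<^esub> = x\<^sub>i z\<^sub>i\<^sup>k\<close>, and
  \<open>z\<^sub>i\<^sup>N = 1\<close>. So \<open>x\<^sub>0, \<dots>, x\<^bsub>d-1\<^esub>, z\<^sub>0, \<dots>, z\<^bsub>d-2\<^esub>\<close> generate the group and define a surjection
  from the claimed direct product. It is injective because each coordinate of the product is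
  recovered by a character of the group.
\<close>

section \<open>Abelianized presentations\<close>

lemma hom_subst_word:
  assumes "group G" "group H" "h \<in> hom G H" "f \<in> X \<rightarrow> carrier G" "set w \<subseteq> X \<times> UNIV"
  shows "h (subst_word G f w) = subst_word H (\<lambda>a. h (f a)) w"
proof -
  interpret group_hom G H h
    using assms(1-3) by (simp add: group_hom_def group_hom_axioms_def)
  show ?thesis using assms(5)
  proof (induction w)
    case (Cons l w)
    obtain a b where l: "l = (a, b)" by (cases l)
    have "f a \<in> carrier G" "subst_word G f w \<in> carrier G"
      using subst_word_closed[OF assms(1,4)] assms(4) Cons.prems l by auto
    with Cons show ?case by (auto simp: subst_word_def l)
  qed (simp add: subst_word_def)
qed

text \<open>In the free group, multiplying on the left by a letter prepends it and cancels, so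
  evaluating any word over \<open>X\<close> at the free generators gives \<open>reduce w\<close>;
  elements of the carrier are already reduced.\<close>

lemma subst_word_free_gen_id:
  assumes "w \<in> carrier (free_group X)"
  shows "subst_word (free_group X) free_gen w = w"
proof -
  interpret group "free_group X" by (rule group_free_group)
  have letter: "(if b then free_gen a else inv\<^bsub>free_group X\<^esub> free_gen a) = [(a, b)]"
    if "a \<in> X" for a b
  proof (cases b)
    case False
    have "inv\<^bsub>free_group X\<^esub> free_gen a = [(a, False)]"
      by (rule inv_equality)
        (use that in \<open>auto simp: free_group_def free_gen_def reduced_def reduce_def cancel_cons_def
          inv_letter_def\<close>)
    with False show ?thesis by simp
  qed (simp add: free_gen_def)
  have "set w \<subseteq> X \<times> UNIV \<Longrightarrow> subst_word (free_group X) free_gen w = reduce w" for w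
  proof (induction w)
    case (Cons l w)
    obtain a b where l: "l = (a, b)" by (cases l)
    have "subst_word (free_group X) free_gen (l # w) = [l] \<otimes>\<^bsub>free_group X\<^esub> reduce w"
      using Cons letter[of a b] by (auto simp: subst_word_def l)
    also have "\<dots> = reduce (l # w)"
      using reduce_append_right[of "[l]" w] by (simp add: free_group_def)
    finally show ?case .
  qed (simp add: subst_word_def free_group_def reduce_def)
  then show ?thesis
    using assms by (simp add: free_group_def reduce_reduced)
qed

text \<open>Uniqueness half of the universal property: \<open>w\<close> is its own evaluation at the
  free generators, and homomorphisms commute with evaluation.\<close>

lemma free_group_hom_eq:
  assumes "group H" "h \<in> hom (free_group X) H" "w \<in> carrier (free_group X)"
  shows "h w = subst_word H (\<lambda>a. h (free_gen a)) w"
proof -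
  have "free_gen \<in> X \<rightarrow> carrier (free_group X)" by (auto intro: free_gen_closed)
  moreover have "set w \<subseteq> X \<times> UNIV" using assms(3) by (simp add: free_group_def)
  ultimately show ?thesis
    using hom_subst_word[OF group_free_group assms(1,2)] subst_word_free_gen_id[OF assms(3)]
    by fastforce
qed

text \<open>The composite of the two quotient maps, from the free group to the presented group and
  on to its abelianization; hence a coset of cosets.\<close>

definition ab_class :: "'a set \<Rightarrow> 'a word set \<Rightarrow> 'a word \<Rightarrow> 'a word set set" where
  "ab_class X R w =
     derived (presented_group X R) (carrier (presented_group X R)) #>\<^bsub>presented_group X R\<^esub>
       (normal_closure (free_group X) R #>\<^bsub>free_group X\<^esub> w)"

context
  fixes X :: "'a set" and R :: "'a word set"
  assumes R: "R \<subseteq> carrier (free_group X)"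
begin

lemma presented_normal: "normal_closure (free_group X) R \<lhd> free_group X"
  by (rule normal_closure_normal[OF group_free_group R])

lemma group_presented_group: "group (presented_group X R)"
  unfolding presented_group_def by (rule normal.factorgroup_is_group[OF presented_normal])

lemma comm_group_abelianization: "comm_group (abelianization (presented_group X R))"
  unfolding abelianization_def
  by (rule group.derived_quot_is_comm_group[OF group_presented_group])

lemma ab_class_hom: "ab_class X R \<in> hom (free_group X) (abelianization (presented_group X R))"
proof -
  let ?P = "presented_group X R"
  have 1: "(\<lambda>w. normal_closure (free_group X) R #>\<^bsub>free_group X\<^esub> w) \<in> hom (free_group X) ?P"
    unfolding presented_group_def by (rule normal.r_coset_hom_Mod[OF presented_normal])
  have 2: "(\<lambda>u. derived ?P (carrier ?P) #>\<^bsub>?P\<^esub> u) \<in> hom ?P (abelianization ?P)"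
    unfolding abelianization_def
    by (rule normal.r_coset_hom_Mod[OF group.derived_self_is_normal[OF group_presented_group]])
  show ?thesis
    using hom_compose[OF 1 2] by (simp add: comp_def ab_class_def[abs_def])
qed

lemma ab_class_surj:
  "carrier (abelianization (presented_group X R)) = ab_class X R ` carrier (free_group X)"
  unfolding abelianization_def ab_class_def
  by (auto simp: presented_group_def FactGroup_def RCOSETS_def)

lemma ab_class_relator:
  assumes "w \<in> R"
  shows "ab_class X R w = \<one>\<^bsub>abelianization (presented_group X R)\<^esub>"
proof -
  let ?P = "presented_group X R"
  interpret N: normal "normal_closure (free_group X) R" "free_group X" by (rule presented_normal)
  interpret P: group ?P by (rule group_presented_group)
  have "w \<in> normal_closure (free_group X) R"
    using assms by (auto simp: normal_closure_def)
  then have "normal_closure (free_group X) R #>\<^bsub>free_group X\<^esub> w = \<one>\<^bsub>?P\<^esub>"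
    using N.rcos_const by (simp add: presented_group_def FactGroup_def)
  then show ?thesis
    using P.coset_mult_one[OF P.derived_in_carrier[OF subset_refl]]
    by (simp add: ab_class_def abelianization_def FactGroup_def)
qed

text \<open>Evaluation at \<open>f\<close> factors twice. Its kernel is one of the normal subgroups
  intersected in the normal closure, and the induced map kills the derived subgroup because the
  derived subgroup of the image in \<open>H\<close> is trivial.\<close>

lemma abelianization_universal:
  assumes "comm_group H" "f \<in> X \<rightarrow> carrier H" "\<And>w. w \<in> R \<Longrightarrow> subst_word H f w = \<one>\<^bsub>H\<^esub>"
  obtains g where "g \<in> hom (abelianization (presented_group X R)) H"
    "\<And>a. a \<in> X \<Longrightarrow> g (ab_class X R (free_gen a)) = f a"
proof -
  let ?F = "free_group X" and ?P = "presented_group X R"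
  interpret H: comm_group H by fact
  interpret F: group ?F by (rule group_free_group)
  interpret P: group ?P by (rule group_presented_group)
  interpret h: group_hom ?F H "subst_word H f"
    by (simp add: group_hom_def group_hom_axioms_def subst_word_hom[OF H.is_group assms(2)])
  have "kernel ?F H (subst_word H f) \<in> {K. K \<lhd> ?F \<and> R \<subseteq> K}"
    using h.normal_kernel assms(3) R by (auto simp: kernel_def)
  then have "normal_closure ?F R \<subseteq> kernel ?F H (subst_word H f)"
    unfolding normal_closure_def by blast
  from h.FactGroup_universal_kernel[OF presented_normal this] obtain k
    where k: "k \<in> hom ?P H"
      "\<And>w. w \<in> carrier ?F \<Longrightarrow> k (normal_closure ?F R #>\<^bsub>?F\<^esub> w) = subst_word H f w"
    unfolding presented_group_def by blast
  interpret k: group_hom ?P H k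
    by (simp add: group_hom_def group_hom_axioms_def k)
  have "k ` derived ?P (carrier ?P) = derived H (k ` carrier ?P)"
    by (simp add: k.derived_img)
  also have "\<dots> = {\<one>\<^bsub>H\<^esub>}"
    by (rule H.derived_eq_singleton) auto
  finally have "derived ?P (carrier ?P) \<subseteq> kernel ?P H k"
    using P.derived_in_carrier[of "carrier ?P"] by (auto simp: kernel_def)
  from k.FactGroup_universal_kernel[OF P.derived_self_is_normal this] obtain g
    where g: "g \<in> hom (abelianization ?P) H"
      "\<And>u. u \<in> carrier ?P \<Longrightarrow> g (derived ?P (carrier ?P) #>\<^bsub>?P\<^esub> u) = k u"
    unfolding abelianization_def by blast
  show thesis
  proof
    fix a assume a: "a \<in> X"
    have gen: "free_gen a \<in> carrier ?F" using a by (rule free_gen_closed)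
    then have "normal_closure ?F R #>\<^bsub>?F\<^esub> free_gen a \<in> carrier ?P"
      by (auto simp: presented_group_def FactGroup_def RCOSETS_def)
    then show "g (ab_class X R (free_gen a)) = f a"
      using g(2) k(2)[OF gen] subst_word_free_gen[OF H.is_group, of f a] assms(2) a
      by (auto simp: ab_class_def)
  qed (rule g(1))
qed

text \<open>Each element is the class of a word, that is, a product of generator classes and their
  inverses.\<close>

lemma abelianization_generated:
  assumes "subgroup K (abelianization (presented_group X R))"
    and "\<And>a. a \<in> X \<Longrightarrow> ab_class X R (free_gen a) \<in> K"
  shows "K = carrier (abelianization (presented_group X R))"
proof
  let ?A = "abelianization (presented_group X R)"
  interpret A: comm_group ?A by (rule comm_group_abelianization)
  interpret K: subgroup K ?A by fact
  show "K \<subseteq> carrier ?A" by (rule K.subset)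
  have "subst_word ?A (\<lambda>a. ab_class X R (free_gen a)) w \<in> K" if "set w \<subseteq> X \<times> UNIV" for w
    using that by (induction w) (auto simp: subst_word_def assms(2))
  then have "ab_class X R w \<in> K" if "w \<in> carrier (free_group X)" for w
    using that free_group_hom_eq[OF A.is_group ab_class_hom that] by (simp add: free_group_def)
  then show "carrier ?A \<subseteq> K" unfolding ab_class_surj by blast
qed

end

section \<open>Periodic sequences in commutative groups\<close>

lemma periodic_mult:
  fixes f :: "nat \<Rightarrow> 'a"
  assumes "\<And>i. f (i + p) = f i"
  shows "f (i + q * p) = f i"
proof (induction q)
  case (Suc q)
  then show ?case using assms[of "i + q * p"] by (simp add: algebra_simps)
qed simp

text \<open>Bezout over the naturals, in the form \<open>n * x = r * y + gcd n r\<close>, avoids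
  negative shifts: moving \<open>i + gcd n r\<close> forward by \<open>y\<close> periods
  \<open>r\<close> lands on \<open>i + x * n\<close>.\<close>

lemma periodic_gcd:
  fixes f :: "nat \<Rightarrow> 'a"
  assumes "n > 0" "\<And>i. f (i + n) = f i" "\<And>i. f (i + r) = f i"
  shows "f (i + gcd n r) = f i"
proof -
  obtain x y where xy: "n * x = r * y + gcd n r"
    using bezout_nat[of n r] assms(1) by auto
  have "f (i + gcd n r) = f (i + gcd n r + y * r)"
    by (rule periodic_mult[of f r, OF assms(3), symmetric])
  also have "\<dots> = f (i + x * n)" by (rule arg_cong[of _ _ f]) (use xy in \<open>simp add: algebra_simps\<close>)
  also have "\<dots> = f i" by (rule periodic_mult[of f n, OF assms(2)])
  finally show ?thesis .
qed

lemma (in comm_group) finprod_split: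
  fixes x :: "nat \<Rightarrow> 'a"
  assumes "\<And>i. x i \<in> carrier G"
  shows "(\<Otimes>k\<in>{..<a + b}. x (i + k)) =
    (\<Otimes>k\<in>{..<a}. x (i + k)) \<otimes> (\<Otimes>k\<in>{..<b}. x (i + a + k))"
  by (induction b) (simp_all add: lessThan_Suc assms Pi_iff m_ac add.assoc)

lemma (in comm_group) fibonacci_relations_periodic:
  fixes x :: "nat \<Rightarrow> 'a" and n r d :: nat
  assumes x: "\<And>i. x i \<in> carrier G" and "n > 0"
    and per: "\<And>i. x (i + n) = x i"
    and rel: "\<And>i. (\<Otimes>k\<in>{..<r}. x (i + k)) = (\<Otimes>k\<in>{..<r}. x (i + r + k))"
    and d: "d = gcd n r"
  shows "inv x (i + d) \<otimes> x (i + d + d) = inv x i \<otimes> x (i + d)"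
    and "(\<Otimes>k\<in>{..<d}. inv x k \<otimes> x (k + d)) = \<one>"
proof -
  define P where "P i m = (\<Otimes>k\<in>{..<m}. x (i + k))" for i m
  have P: "P i m \<in> carrier G" for i m
    by (simp add: P_def x Pi_iff)
  have split: "P i (a + b) = P i a \<otimes> P (i + a) b" for i a b
    unfolding P_def by (rule finprod_split[OF x])
  have P_n: "P (i + n) m = P i m" for i m
    using per[of "i + k" for k] by (simp add: P_def algebra_simps)
  have P_r: "P (i + d) r = P i r" for i
    unfolding d
    by (rule periodic_gcd[where f = "\<lambda>i. P i r", OF \<open>n > 0\<close> P_n])
      (rule rel[folded P_def, symmetric])
  have "P (i + r) d = P i d" for i
  proof -
    have "P i r \<otimes> P (i + r) d = P i d \<otimes> P (i + d) r"
      using split[of i r d] split[of i d r] by (simp add: add.commute)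
    also have "\<dots> = P i r \<otimes> P i d"
      by (simp add: P_r P m_comm)
    finally show ?thesis using P by simp
  qed
  then have P_d: "P (i + d) d = P i d" for i
    unfolding d
    using periodic_gcd[where f = "\<lambda>i. P i (gcd n r)" and n = n and r = r, OF \<open>n > 0\<close> P_n] d
    by blast
  have one: "P i (Suc 0) = x i" for i
    by (simp add: P_def x lessThan_Suc)
  \<comment> \<open>The two splittings of the window of length \<open>d + 1\<close> at
    \<open>i\<close> turn a quotient of entries into a quotient of adjacent windows.\<close>
  have step: "inv x i \<otimes> x (i + d) = inv P i d \<otimes> P (i + 1) d" for i
  proof -
    have "x i \<otimes> P (i + 1) d = P i d \<otimes> x (i + d)"
      using split[of i 1 d] split[of i d 1] by (simp add: one)
    then have "P (i + 1) d = inv x i \<otimes> (P i d \<otimes> x (i + d))"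
      using x P by (simp add: inv_solve_left)
    also have "\<dots> = P i d \<otimes> (inv x i \<otimes> x (i + d))"
      using x P by (simp add: m_lcomm)
    finally show ?thesis
      using x P by (simp add: inv_solve_left)
  qed
  show "inv x (i + d) \<otimes> x (i + d + d) = inv x i \<otimes> x (i + d)"
    using step[of i] step[of "i + d"] P_d[of i] P_d[of "i + 1"] by simp
  \<comment> \<open>By \<open>step\<close> this product telescopes; at \<open>m = d\<close> it is
    trivial because \<open>P d d = P 0 d\<close>.\<close>
  have "(\<Otimes>k\<in>{..<m}. inv x k \<otimes> x (k + d)) = inv P 0 d \<otimes> P m d" for m
  proof (induction m)
    case (Suc m)
    have "inv P m d \<otimes> P (Suc m) d \<otimes> (inv P 0 d \<otimes> P m d) =
        inv P 0 d \<otimes> P m d \<otimes> (inv P m d \<otimes> P (Suc m) d)"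
      using P by (intro m_comm) auto
    also have "\<dots> = inv P 0 d \<otimes> (P m d \<otimes> inv P m d) \<otimes> P (Suc m) d"
      using P by (simp only: m_assoc inv_closed m_closed)
    also have "\<dots> = inv P 0 d \<otimes> P (Suc m) d" using P by simp
    finally show ?case
      using step[of m] Suc x P by (simp add: lessThan_Suc Pi_iff del: finprod_multf)
  qed (use P in simp)
  then show "(\<Otimes>k\<in>{..<d}. inv x k \<otimes> x (k + d)) = \<one>"
    using P_d[of 0] P by simp
qed

text \<open>Along a progression of difference \<open>d\<close> the quotient of neighbours is
  constant, so the entries form a geometric progression.\<close>

lemma (in comm_group) step_periodic_pow:
  fixes x :: "nat \<Rightarrow> 'a"
  assumes x: "\<And>i. x i \<in> carrier G"
    and step: "\<And>i. inv x (i + d) \<otimes> x (i + d + d) = inv x i \<otimes> x (i + d)"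
  shows "x (i + q * d) = x i \<otimes> (inv x i \<otimes> x (i + d)) [^] q"
proof (induction q)
  case (Suc q)
  have "x (i + Suc q * d) = x (i + q * d) \<otimes> (inv x (i + q * d) \<otimes> x (i + q * d + d))"
    using x by (simp add: m_assoc[symmetric] algebra_simps)
  also have "inv x (i + q * d) \<otimes> x (i + q * d + d) = inv x i \<otimes> x (i + d)"
    by (rule periodic_mult[where f = "\<lambda>i. inv x i \<otimes> x (i + d)", OF step])
  finally show ?case using Suc x by (simp add: m_assoc)
qed (use x in simp)

section \<open>Finite products and homomorphisms from products of cyclic groups\<close>

lemma (in comm_group) foldr_eq_finprod:
  assumes "distinct js" "x \<in> set js \<rightarrow> carrier G"
  shows "foldr (\<lambda>j g. x j \<otimes> g) js \<one> = (\<Otimes>j\<in>set js. x j)"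
  using assms by (induction js) (auto simp: Pi_iff)

lemma (in group_hom) hom_finprod:
  assumes "comm_group G" "comm_group H" "finite A" "f \<in> A \<rightarrow> carrier G"
  shows "h (finprod G f A) = finprod H (\<lambda>a. h (f a)) A"
proof -
  interpret G: comm_group G by fact
  interpret H: comm_group H by fact
  show ?thesis using assms(3,4)
    by (induction A) (auto simp: Pi_iff)
qed

lemma (in group) int_pow_mod_eq:
  assumes "y \<in> carrier G" "y [^] m = \<one>"
  shows "y [^] (k mod int m) = y [^] k"
proof -
  have "y [^] (int m * (k div int m)) = \<one>"
    using assms int_pow_pow[of y "int m" "k div int m"] by (simp add: int_pow_int)
  then show ?thesis
    using int_pow_mult[OF assms(1), of "int m * (k div int m)" "k mod int m"] assms(1)
    by simp
qed

text \<open>The reduction modulo \<open>m\<close> in each coordinate is invisible to a power of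
  \<open>y i\<close>. The case \<open>m = 0\<close> covers infinite cyclic factors, where the power
  condition is vacuous.\<close>

lemma (in comm_group) hom_product_integer_mod_group:
  assumes "finite I" "y \<in> I \<rightarrow> carrier G" "\<And>i. i \<in> I \<Longrightarrow> y i [^] m = \<one>"
  shows "(\<lambda>a. \<Otimes>i\<in>I. y i [^] (a i :: int)) \<in> hom (product_group I (\<lambda>_. integer_mod_group m)) G"
proof (rule homI)
  fix a b
  have y: "y i [^] k \<in> carrier G" if "i \<in> I" for i and k :: int
    using assms(2) that by auto
  have "(\<Otimes>i\<in>I. y i [^] (a \<otimes>\<^bsub>product_group I (\<lambda>_. integer_mod_group m)\<^esub> b) i) =
      (\<Otimes>i\<in>I. y i [^] a i \<otimes> y i [^] b i)"
    using assms(2,3) by (intro finprod_cong') (auto simp: int_pow_mod_eq int_pow_mult Pi_iff)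
  also have "\<dots> = (\<Otimes>i\<in>I. y i [^] a i) \<otimes> (\<Otimes>i\<in>I. y i [^] b i)"
    using y by (intro finprod_multf) auto
  finally show "(\<Otimes>i\<in>I. y i [^] (a \<otimes>\<^bsub>product_group I (\<lambda>_. integer_mod_group m)\<^esub> b) i) =
      (\<Otimes>i\<in>I. y i [^] a i) \<otimes> (\<Otimes>i\<in>I. y i [^] b i)" .
qed (use assms(2) in \<open>auto intro!: finprod_closed\<close>)

section \<open>Values of the defining word in commutative groups\<close>

text \<open>The product is indexed by subscripts before reduction modulo \<open>n\<close>, so a
  generator that occurs several times keeps its multiplicity although \<open>js\<close> is
  distinct.\<close>

lemma gen_product_hom:
  assumes "comm_group H" "h \<in> hom (free_group {..<n}) H" "n > 0" "distinct js"
  shows "h (gen_product n js) = finprod H (\<lambda>j. h (free_gen (j mod n))) (set js)"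
proof -
  let ?F = "free_group {..<n}"
  interpret H: comm_group H by fact
  interpret group_hom ?F H h
    by (simp add: group_hom_def group_hom_axioms_def assms(2) group_free_group)
  have gen: "free_gen (j mod n) \<in> carrier ?F" for j
    using \<open>n > 0\<close> by (auto intro: free_gen_closed)
  have "h (gen_product n js) = foldr (\<lambda>j g. h (free_gen (j mod n)) \<otimes>\<^bsub>H\<^esub> g) js \<one>\<^bsub>H\<^esub>"
  proof (induction js)
    case (Cons j js)
    then show ?case
      using gen gen_product_closed[OF \<open>n > 0\<close>, of js] by (simp add: gen_product_def)
  qed (simp add: gen_product_def)
  then show ?thesis
    using H.foldr_eq_finprod[OF assms(4), of "\<lambda>j. h (free_gen (j mod n))"] gen by auto
qed

lemma fibonacci_word_hom:
  assumes "comm_group H" "h \<in> hom (free_group {..<n}) H" "n > 0"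
  shows "h (fibonacci_word r n s) =
    finprod H (\<lambda>k. h (free_gen (k mod n))) {..<r} \<otimes>\<^bsub>H\<^esub>
      inv\<^bsub>H\<^esub> finprod H (\<lambda>k. h (free_gen ((r + k) mod n))) {..<s}"
proof -
  interpret H: comm_group H by fact
  interpret group_hom "free_group {..<n}" H h
    by (simp add: group_hom_def group_hom_axioms_def assms(2) group_free_group)
  have "finprod H (\<lambda>k. h (free_gen (k mod n))) {r..<r + s} =
      finprod H (\<lambda>k. h (free_gen (k mod n))) ((+) r ` {..<s})"
    by (simp add: lessThan_atLeast0 add.commute)
  also have "\<dots> = finprod H (\<lambda>k. h (free_gen ((r + k) mod n))) {..<s}"
    using \<open>n > 0\<close> by (intro H.finprod_reindex) (auto intro!: hom_closed free_gen_closed)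
  finally show ?thesis
    using gen_product_hom[OF assms] gen_product_closed[OF \<open>n > 0\<close>]
    by (simp add: fibonacci_word_def atLeast0LessThan)
qed

lemma subst_fibonacci_word:
  assumes "comm_group H" "\<And>i. x i \<in> carrier H" "n > 0" "\<And>i. x (i + n) = x i"
  shows "subst_word H (\<lambda>j. x (i + j)) (fibonacci_word r n s) =
    finprod H (\<lambda>k. x (i + k)) {..<r} \<otimes>\<^bsub>H\<^esub> inv\<^bsub>H\<^esub> finprod H (\<lambda>k. x (i + r + k)) {..<s}"
proof -
  interpret H: comm_group H by fact
  have "x (i + k mod n) = x (i + k)" for k
    using periodic_mult[of x n "i + k mod n" "k div n"] assms(4) by (simp add: add.assoc)
  moreover have "subst_word H (\<lambda>j. x (i + j)) \<in> hom (free_group {..<n}) H"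
    by (rule subst_word_hom) (use assms(2) in auto)
  ultimately show ?thesis
    using fibonacci_word_hom[OF assms(1), of "subst_word H (\<lambda>j. x (i + j))" n r s] assms(2,3)
    by (simp add: subst_word_free_gen add.assoc)
qed

section \<open>Generalized Fibonacci groups\<close>

definition fibonacci_relators :: "nat \<Rightarrow> nat \<Rightarrow> nat \<Rightarrow> nat word set" where
  "fibonacci_relators r n s =
     (\<lambda>i. subst_word (free_group {..<n}) (\<lambda>j. free_gen ((i + j) mod n)) (fibonacci_word r n s)) ` {..<n}"

lemma gen_fibonacci_group_eq:
  "gen_fibonacci_group r n s = presented_group {..<n} (fibonacci_relators r n s)"
  by (simp add: gen_fibonacci_group_def cyclically_presented_group_def fibonacci_relators_def)

lemma fibonacci_word_letters: "n > 0 \<Longrightarrow> set (fibonacci_word r n s) \<subseteq> {..<n} \<times> UNIV"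
  using fibonacci_word_closed[of n r s] by (simp add: free_group_def)

lemma fibonacci_relators_closed:
  assumes "n > 0"
  shows "fibonacci_relators r n s \<subseteq> carrier (free_group {..<n})"
  unfolding fibonacci_relators_def
  using assms
  by (auto intro!: subst_word_closed[OF group_free_group _ fibonacci_word_letters] free_gen_closed)

text \<open>Indexing by all naturals makes the generators an \<open>n\<close>-periodic sequence, as
  the periodicity lemmas expect.\<close>

definition fib_gen :: "nat \<Rightarrow> nat \<Rightarrow> nat \<Rightarrow> nat \<Rightarrow> nat word set set" where
  "fib_gen r n s i = ab_class {..<n} (fibonacci_relators r n s) (free_gen (i mod n))"

context
  fixes r n s :: nat
  assumes n: "n > 0"
begin

lemma comm_group_fibonacci_ab: "comm_group (abelianization (gen_fibonacci_group r n s))"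
  unfolding gen_fibonacci_group_eq
  by (rule comm_group_abelianization[OF fibonacci_relators_closed[OF n]])

lemma fib_gen_closed: "fib_gen r n s i \<in> carrier (abelianization (gen_fibonacci_group r n s))"
  unfolding gen_fibonacci_group_eq fib_gen_def
  by (rule hom_in_carrier[OF ab_class_hom[OF fibonacci_relators_closed[OF n]]])
    (use n in \<open>auto intro: free_gen_closed\<close>)

lemma fib_gen_relation:
  "finprod (abelianization (gen_fibonacci_group r n s)) (\<lambda>k. fib_gen r n s (i + k)) {..<r} =
   finprod (abelianization (gen_fibonacci_group r n s)) (\<lambda>k. fib_gen r n s (i + r + k)) {..<s}"
    (is "finprod ?A _ _ = _")
proof -
  interpret A: comm_group ?A by (rule comm_group_fibonacci_ab)
  \<comment> \<open>Relators exist only for starting subscripts below \<open>n\<close>; periodicity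
    carries the relation to every \<open>i\<close>.\<close>
  let ?i = "i mod n"
  have per: "fib_gen r n s (i + n) = fib_gen r n s i" for i
    by (simp add: fib_gen_def)
  have shift: "fib_gen r n s (?i + k) = fib_gen r n s (i + k)" for k
    by (simp add: fib_gen_def mod_add_left_eq)
  have "subst_word (free_group {..<n}) (\<lambda>j. free_gen ((?i + j) mod n)) (fibonacci_word r n s)
      \<in> fibonacci_relators r n s"
    using n by (auto simp: fibonacci_relators_def)
  from ab_class_relator[OF fibonacci_relators_closed[OF n] this]
  have "\<one>\<^bsub>?A\<^esub> = ab_class {..<n} (fibonacci_relators r n s)
      (subst_word (free_group {..<n}) (\<lambda>j. free_gen ((?i + j) mod n)) (fibonacci_word r n s))"
    by (simp add: gen_fibonacci_group_eq)
  also have "\<dots> = subst_word ?A (\<lambda>j. fib_gen r n s (?i + j)) (fibonacci_word r n s)"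
    unfolding fib_gen_def
    by (rule hom_subst_word[OF group_free_group A.is_group _ _ fibonacci_word_letters[OF n]])
      (use n ab_class_hom[OF fibonacci_relators_closed[OF n]] in
        \<open>auto simp: gen_fibonacci_group_eq intro: free_gen_closed\<close>)
  also have "\<dots> = finprod ?A (\<lambda>k. fib_gen r n s (i + k)) {..<r} \<otimes>\<^bsub>?A\<^esub>
      inv\<^bsub>?A\<^esub> finprod ?A (\<lambda>k. fib_gen r n s (i + r + k)) {..<s}"
    using subst_fibonacci_word[where x = "fib_gen r n s" and i = ?i and r = r and s = s,
      OF A.comm_group_axioms fib_gen_closed n per]
    by (simp add: shift add.assoc)
  finally show ?thesis
    using fib_gen_closed by (simp add: A.inv_solve_right Pi_iff)
qed

lemma fibonacci_ab_generated:
  assumes "subgroup K (abelianization (gen_fibonacci_group r n s))" "\<And>i. i < n \<Longrightarrow> fib_gen r n s i \<in> K"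
  shows "K = carrier (abelianization (gen_fibonacci_group r n s))"
  unfolding gen_fibonacci_group_eq
  by (rule abelianization_generated[OF fibonacci_relators_closed[OF n]])
    (use assms in \<open>auto simp: gen_fibonacci_group_eq fib_gen_def\<close>)

text \<open>A relator is the defining word evaluated at shifted generators, so its value at
  \<open>x\<close> is that word evaluated at the shifted sequence; the window equation makes this
  value trivial.\<close>

lemma fibonacci_ab_universal:
  assumes H: "comm_group H" and x: "\<And>i. x i \<in> carrier H" "\<And>i. x (i + n) = x i"
    and rel: "\<And>i. finprod H (\<lambda>k. x (i + k)) {..<r} = finprod H (\<lambda>k. x (i + r + k)) {..<s}"
  obtains g where "g \<in> hom (abelianization (gen_fibonacci_group r n s)) H"
    "\<And>i. g (fib_gen r n s i) = x i"
proof -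
  interpret H: comm_group H by fact
  have x_mod: "x (i mod n) = x i" for i
    using periodic_mult[of x n "i mod n" "i div n"] x(2) by simp
  have "subst_word H x w = \<one>\<^bsub>H\<^esub>" if w: "w \<in> fibonacci_relators r n s" for w
  proof -
    obtain i where w: "w = subst_word (free_group {..<n}) (\<lambda>j. free_gen ((i + j) mod n))
        (fibonacci_word r n s)"
      using w by (auto simp: fibonacci_relators_def)
    have "subst_word H x w =
        subst_word H (\<lambda>j. subst_word H x (free_gen ((i + j) mod n))) (fibonacci_word r n s)"
      unfolding w
      by (rule hom_subst_word[OF group_free_group H.is_group subst_word_hom _ fibonacci_word_letters[OF n]])
        (use n x(1) in \<open>auto intro: free_gen_closed\<close>)
    also have "\<dots> = subst_word H (\<lambda>j. x (i + j)) (fibonacci_word r n s)"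
      by (simp add: subst_word_free_gen x(1) x_mod)
    also have "\<dots> = \<one>\<^bsub>H\<^esub>"
      using subst_fibonacci_word[where x = x and i = i and r = r and s = s, OF H x(1) n x(2)]
        x(1) rel[of i] by (simp add: Pi_iff)
    finally show ?thesis .
  qed
  then obtain g where g: "g \<in> hom (abelianization (gen_fibonacci_group r n s)) H"
    "\<And>i. i < n \<Longrightarrow> g (ab_class {..<n} (fibonacci_relators r n s) (free_gen i)) = x i"
    using abelianization_universal[OF fibonacci_relators_closed[OF n] H, of x r s] x(1)
    unfolding gen_fibonacci_group_eq by (metis (no_types, lifting) Pi_I lessThan_iff)
  show thesis
    by (rule that[OF g(1)]) (use n g(2) x_mod in \<open>simp add: fib_gen_def\<close>)
qed

end

section \<open>Characters of the abelianized group\<close>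

lemma finprod_integer_mod_group:
  assumes "finite A"
  shows "finprod (integer_mod_group m) (\<lambda>a. c a mod int m) A = (\<Sum>a\<in>A. c a) mod int m"
proof -
  interpret comm_group "integer_mod_group m" by simp
  have "c a mod int m \<in> carrier (integer_mod_group m)" for a
    by (simp add: carrier_integer_mod_group)
  with assms show ?thesis
    by (induction A) (simp_all add: Pi_iff mod_add_eq)
qed

text \<open>The window condition is an identity of integers, so it survives reduction modulo any
  \<open>m\<close>. With \<open>m = 0\<close> the character is integer-valued; thus the same lemma
  serves the free and the torsion coordinates.\<close>

lemma fibonacci_ab_character:
  fixes c :: "nat \<Rightarrow> int"
  assumes n: "n > 0" and per: "\<And>i. c (i + n) mod int m = c i mod int m"
    and rel: "\<And>i. (\<Sum>k<r. c (i + r + k) - c (i + k)) = 0"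
  obtains g where "g \<in> hom (abelianization (gen_fibonacci_group r n r)) (integer_mod_group m)"
    "\<And>i. g (fib_gen r n r i) = c i mod int m"
proof (rule fibonacci_ab_universal[OF n, where x = "\<lambda>i. c i mod int m"])
  show "comm_group (integer_mod_group m)" by simp
  show "c i mod int m \<in> carrier (integer_mod_group m)" for i
    by (simp add: carrier_integer_mod_group)
  show "finprod (integer_mod_group m) (\<lambda>k. c (i + k) mod int m) {..<r} =
      finprod (integer_mod_group m) (\<lambda>k. c (i + r + k) mod int m) {..<r}" for i
    using rel[of i] by (simp add: finprod_integer_mod_group sum_subtractf)
qed (use per that in auto)

text \<open>Moving a window of length \<open>d\<close> by one place trades \<open>f i\<close> for
  \<open>f (i + d)\<close>, so all such windows have the same sum.\<close>

lemma sum_periodic_block: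
  fixes f :: "nat \<Rightarrow> int"
  assumes "\<And>i. f (i + d) = f i"
  shows "(\<Sum>k<q * d. f (i + k)) = int q * (\<Sum>k<d. f k)"
proof -
  have shift: "(\<Sum>k<d. f (i + k)) = (\<Sum>k<d. f k)" for i
  proof (induction i)
    case (Suc i)
    have "(\<Sum>k<d. f (Suc i + k)) + f i = (\<Sum>k<Suc d. f (i + k))"
      by (subst sum.lessThan_Suc_shift) simp
    also have "\<dots> = (\<Sum>k<d. f (i + k)) + f i" by (simp add: assms)
    finally show ?case using Suc by simp
  qed simp
  show ?thesis
  proof (induction q)
    case (Suc q)
    have "(\<Sum>k<q * d + b. f (i + k)) = (\<Sum>k<q * d. f (i + k)) + (\<Sum>k<b. f (i + q * d + k))" for b
      by (induction b) (simp_all add: add.assoc)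
    from this[of d] show ?case using Suc shift[of "i + q * d"] by (simp add: algebra_simps)
  qed simp
qed

theorem theorem4p8:
  fixes n r d N :: nat
  assumes "n \<ge> 2" and "r \<ge> 1"
    and "d = gcd n r" and "N = n div d"
  shows "abelianization (gen_fibonacci_group r n r) \<cong>
           product_group {..<d - 1} (\<lambda>_. integer_mod_group N) \<times>\<times>
           product_group {..<d} (\<lambda>_. integer_group)"
proof -
  let ?A = "abelianization (gen_fibonacci_group r n r)"
  let ?S = "product_group {..<d - 1} (\<lambda>_. integer_mod_group N)"
  let ?L = "product_group {..<d} (\<lambda>_. integer_group)"

  \<comment> \<open>The sequence of generators and its quotients\<close>
  define X where "X = fib_gen r n r"
  have n: "n > 0" and d: "d > 0" and nd: "n = N * d" and N: "N > 0"
    using assms by (auto simp: div_greater_zero_iff)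
  obtain q where r: "r = q * d"
    using assms(3) by (metis dvdE gcd_dvd2 mult.commute)
  interpret A: comm_group ?A by (rule comm_group_fibonacci_ab[OF n])
  have X: "X i \<in> carrier ?A" for i
    unfolding X_def by (rule fib_gen_closed[OF n])
  have X_per: "X (i + n) = X i" for i
    by (simp add: X_def fib_gen_def)
  define Z where "Z i = inv\<^bsub>?A\<^esub> X i \<otimes>\<^bsub>?A\<^esub> X (i + d)" for i
  have Z: "Z i \<in> carrier ?A" for i
    by (simp add: Z_def X)
  \<comment> \<open>With \<open>s = r\<close> both sides of a relation are windows of length
    \<open>r\<close>, as required here.\<close>
  note relations = A.fibonacci_relations_periodic[where x = X and n = n and r = r and d = d,
      OF X n X_per fib_gen_relation[OF n, of r r, folded X_def] assms(3)]
  have Z_prod: "finprod ?A Z {..<d} = \<one>\<^bsub>?A\<^esub>"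
    using relations(2) by (simp add: Z_def[abs_def])
  have X_pow: "X (i + k * d) = X i \<otimes>\<^bsub>?A\<^esub> Z i [^]\<^bsub>?A\<^esub> k" for i k
    unfolding Z_def by (rule A.step_periodic_pow[where x = X, OF X relations(1)])
  \<comment> \<open>A shift by \<open>N * d = n\<close> is a full period, so \<open>X_pow\<close>
    returns to \<open>X i\<close> and the power cancels.\<close>
  have Z_N: "Z i [^]\<^bsub>?A\<^esub> N = \<one>\<^bsub>?A\<^esub>" for i
    using X_pow[of i N] X_per[of i] X[of i] Z[of i] by (simp add: nd[symmetric])

  \<comment> \<open>The homomorphism from the direct product\<close>
  define \<phi> where "\<phi> a = finprod ?A (\<lambda>j. Z j [^]\<^bsub>?A\<^esub> (a j :: int)) {..<d - 1}" for a
  define \<chi> where "\<chi> b = finprod ?A (\<lambda>j. X j [^]\<^bsub>?A\<^esub> (b j :: int)) {..<d}" for b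
  define \<psi> where "\<psi> p = \<phi> (fst p) \<otimes>\<^bsub>?A\<^esub> \<chi> (snd p)" for p
  have \<phi>_hom: "\<phi> \<in> hom ?S ?A"
    unfolding \<phi>_def[abs_def] by (rule A.hom_product_integer_mod_group) (auto simp: Z Z_N)
  \<comment> \<open>\<open>integer_mod_group 0\<close> is \<open>integer_group\<close>.\<close>
  have "\<chi> \<in> hom (product_group {..<d} (\<lambda>_. integer_mod_group 0)) ?A"
    unfolding \<chi>_def[abs_def] by (rule A.hom_product_integer_mod_group) (auto simp: X)
  then have \<chi>_hom: "\<chi> \<in> hom ?L ?A"
    by (simp add: integer_mod_group_def)
  have \<phi>_closed: "\<phi> a \<in> carrier ?A" and \<chi>_closed: "\<chi> b \<in> carrier ?A" for a b
    by (auto simp: \<phi>_def \<chi>_def X Z intro!: A.finprod_closed)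
  have \<psi>_hom: "\<psi> \<in> hom (?S \<times>\<times> ?L) ?A"
  proof (rule homI)
    fix p p' assume "p \<in> carrier (?S \<times>\<times> ?L)" "p' \<in> carrier (?S \<times>\<times> ?L)"
    then have "\<phi> (fst (p \<otimes>\<^bsub>?S \<times>\<times> ?L\<^esub> p')) = \<phi> (fst p) \<otimes>\<^bsub>?A\<^esub> \<phi> (fst p')"
      "\<chi> (snd (p \<otimes>\<^bsub>?S \<times>\<times> ?L\<^esub> p')) = \<chi> (snd p) \<otimes>\<^bsub>?A\<^esub> \<chi> (snd p')"
      using hom_mult[OF \<phi>_hom, of "fst p" "fst p'"] hom_mult[OF \<chi>_hom, of "snd p" "snd p'"]
      by (auto simp: DirProd_def)
    then show "\<psi> (p \<otimes>\<^bsub>?S \<times>\<times> ?L\<^esub> p') = \<psi> p \<otimes>\<^bsub>?A\<^esub> \<psi> p'"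
      by (simp add: \<psi>_def A.m_ac \<phi>_closed \<chi>_closed)
  qed (simp add: \<psi>_def \<phi>_closed \<chi>_closed)

  \<comment> \<open>A character with values \<open>c\<close> on \<open>X\<close> sends
    \<open>Z j\<close> to \<open>c (j + d) - c j\<close>, hence is a linear form in the exponents
    modulo \<open>m\<close>.\<close>
  have character: "g (\<psi> (a, b)) =
      ((\<Sum>j<d - 1. a j * (c (j + d) - c j)) + (\<Sum>j<d. b j * c j)) mod int m"
    if g: "g \<in> hom ?A (integer_mod_group m)" "\<And>i. g (X i) = c i mod int m" for g c m a b
  proof -
    interpret g: group_hom ?A "integer_mod_group m" g
      by (simp add: group_hom_def group_hom_axioms_def g A.is_group)
    have gZ: "g (Z j) = (c (j + d) - c j) mod int m" for j
      using X by (simp add: Z_def g(2) carrier_integer_mod_group mod_simps)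
    have pow: "g (u [^]\<^bsub>?A\<^esub> k) = (k * e) mod int m"
      if "u \<in> carrier ?A" "g u = e mod int m" for u k e
      using that by (simp add: g.hom_int_pow int_pow_integer_mod_group mod_mult_right_eq)
    have "g (\<phi> a) = (\<Sum>j<d - 1. a j * (c (j + d) - c j)) mod int m"
      unfolding \<phi>_def
      by (subst g.hom_finprod)
        (auto simp: A.comm_group_axioms Z pow[OF Z gZ] finprod_integer_mod_group)
    moreover have "g (\<chi> b) = (\<Sum>j<d. b j * c j) mod int m"
      unfolding \<chi>_def
      by (subst g.hom_finprod)
        (auto simp: A.comm_group_axioms X pow[OF X g(2)] finprod_integer_mod_group)
    ultimately show ?thesis
      by (simp add: \<psi>_def \<phi>_closed \<chi>_closed mod_add_eq)
  qed

  \<comment> \<open>Characters that read off the exponents\<close>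
  have b_coord: "\<exists>h. \<forall>a b. h (\<psi> (a, b)) = b k" if k: "k < d" for k
  proof -
    \<comment> \<open>The indicator of a residue class modulo \<open>d\<close> has period
      \<open>d\<close>: the differences \<open>c (j + d) - c j\<close> vanish, which removes
      \<open>a\<close>, and windows shifted by \<open>r = q * d\<close> agree term by term.\<close>
    define c :: "nat \<Rightarrow> int" where "c i = of_bool (i mod d = k)" for i
    have c_per: "c (i + p * d) = c i" for i p
      by (simp add: c_def)
    obtain g where g: "g \<in> hom ?A (integer_mod_group 0)" "\<And>i. g (X i) = c i mod int 0"
    proof (rule fibonacci_ab_character[OF n, of c 0 r])
      show "c (i + n) mod int 0 = c i mod int 0" for i
        using c_per[of i N] by (simp add: nd)
      show "(\<Sum>k<r. c (i + r + k) - c (i + k)) = 0" for i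
        using c_per[of "i + k" q for k] by (simp add: r add.assoc add.commute[of "q * d"])
    qed (use that in \<open>auto simp: X_def\<close>)
    have "g (\<psi> (a, b)) = b k" for a b
    proof -
      have "(\<Sum>j<d. b j * c j) = (\<Sum>j<d. if j = k then b j else 0)"
        by (rule sum.cong) (auto simp: c_def)
      then show ?thesis
        using k character[OF g, of a b] c_per[of _ 1] by simp
    qed
    then show ?thesis by blast
  qed

  have a_coord: "\<exists>h. \<forall>a b. h (\<psi> (a, b)) = a k mod int N" if k: "k < d - 1" for k
  proof -
    \<comment> \<open>For \<open>i = p d + j\<close> with \<open>j < d\<close> we have \<open>x\<^sub>i = x\<^sub>j z\<^sub>j\<^sup>p\<close>; the character reads off the exponent
      of \<open>z\<^sub>k\<close> after replacing \<open>z\<^bsub>d-1\<^esub>\<close> by the inverse of the product of the other \<open>z\<^sub>j\<close>.\<close>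
    define s :: "nat \<Rightarrow> int" where "s i = of_bool (i mod d = k) - of_bool (i mod d = d - 1)" for i
    define c :: "nat \<Rightarrow> int" where "c i = int (i div d) * s i" for i
    have s_per: "s (i + p * d) = s i" for i p
      by (simp add: s_def)
    have c_shift: "c (i + p * d) = c i + int p * s i" for i p
      using d s_per[of i p] by (simp add: c_def algebra_simps)
    have s_sum: "(\<Sum>j<d. s j) = 0"
    proof -
      have "(\<Sum>j<d. s j) = (\<Sum>j<d. if j = k then 1 else 0) - (\<Sum>j<d. if j = d - 1 then 1 else 0)"
        unfolding sum_subtractf[symmetric] by (rule sum.cong) (auto simp: s_def)
      then show ?thesis using k by simp
    qed
    obtain g where g: "g \<in> hom ?A (integer_mod_group N)" "\<And>i. g (X i) = c i mod int N"
    proof (rule fibonacci_ab_character[OF n, of c N r])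
      \<comment> \<open>A shift by \<open>n = N * d\<close> changes \<open>c\<close> by
        \<open>int N * s i\<close>, hence the values modulo \<open>N\<close>.\<close>
      show "c (i + n) mod int N = c i mod int N" for i
        using c_shift[of i N] by (simp add: nd)
      show "(\<Sum>k<r. c (i + r + k) - c (i + k)) = 0" for i
      proof -
        \<comment> \<open>A shift by \<open>r = q * d\<close> adds \<open>int q * s (i + k)\<close>
          to each term, and \<open>s\<close> sums to zero over \<open>q\<close> full
          periods.\<close>
        have "(\<Sum>k<r. c (i + r + k) - c (i + k)) = (\<Sum>k<r. int q * s (i + k))"
          using c_shift[of "i + k" q for k] by (simp add: r add.assoc add.commute[of "q * d"])
        also have "\<dots> = 0"
          using sum_periodic_block[where f = s and d = d and q = q and i = i] s_per[of _ 1] s_sum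
          by (simp add: r sum_distrib_left[symmetric])
        finally show ?thesis .
      qed
    qed (use that in \<open>auto simp: X_def\<close>)
    have "g (\<psi> (a, b)) = a k mod int N" for a b
    proof -
      \<comment> \<open>For \<open>j < d\<close> the factor \<open>j div d\<close> is 0, so
        \<open>b\<close> does not contribute.\<close>
      have "(\<Sum>j<d. b j * c j) = 0"
        by (rule sum.neutral) (auto simp: c_def)
      moreover have "(\<Sum>j<d - 1. a j * (c (j + d) - c j)) = (\<Sum>j<d - 1. if j = k then a j else 0)"
        using c_shift[of _ 1] by (intro sum.cong) (auto simp: s_def)
      ultimately show ?thesis
        using k character[OF g, of a b] by simp
    qed
    then show ?thesis by blast
  qed

  \<comment> \<open>Injectivity\<close>
  have "inj_on \<psi> (carrier (?S \<times>\<times> ?L))"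
  proof (rule inj_onI)
    fix p p' assume p: "p \<in> carrier (?S \<times>\<times> ?L)" "p' \<in> carrier (?S \<times>\<times> ?L)" and eq: "\<psi> p = \<psi> p'"
    obtain a b a' b' where ab: "p = (a, b)" "p' = (a', b')" by (cases p, cases p')
    have b: "b k = b' k" if "k < d" for k
      using b_coord[OF that] eq by (auto simp: ab) metis
    have a: "a k = a' k" if "k < d - 1" for k
    proof -
      \<comment> \<open>As \<open>N > 0\<close>, the carrier consists of the residues from 0 to
        \<open>N - 1\<close>, so this congruence is an equality.\<close>
      have "a k mod int N = a' k mod int N"
        using a_coord[OF that] eq by (auto simp: ab) metis
      then show ?thesis
        using p that N by (auto simp: ab PiE_iff carrier_integer_mod_group)
    qed
    have "a = a'"
      by (rule PiE_ext[where k = "{..<d - 1}" and s = "\<lambda>_. carrier (integer_mod_group N)"])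
        (use p a in \<open>auto simp: ab\<close>)
    moreover have "b = b'"
      by (rule PiE_ext[where k = "{..<d}" and s = "\<lambda>_. UNIV"]) (use p b in \<open>auto simp: ab\<close>)
    ultimately show "p = p'" by (simp add: ab)
  qed
  moreover have T: "group (?S \<times>\<times> ?L)"
    by (intro DirProd_group) auto

  \<comment> \<open>Surjectivity\<close>
  moreover have "\<psi> ` carrier (?S \<times>\<times> ?L) = carrier ?A"
  proof -
    let ?K = "\<psi> ` carrier (?S \<times>\<times> ?L)"
    interpret \<psi>: group_hom "?S \<times>\<times> ?L" ?A \<psi>
      using T A.is_group \<psi>_hom by (simp add: group_hom_def group_hom_axioms_def)
    have K: "subgroup ?K ?A"
      by (rule \<psi>.img_is_subgroup)
    interpret K: subgroup ?K ?A by (rule K)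
    \<comment> \<open>The exponents are arbitrary integer functions; reducing and restricting them
      yields a carrier element with the same value.\<close>
    have image: "\<phi> a \<otimes>\<^bsub>?A\<^esub> \<chi> b \<in> ?K" for a b
    proof (rule image_eqI)
      let ?a = "\<lambda>j\<in>{..<d - 1}. a j mod int N" and ?b = "\<lambda>j\<in>{..<d}. b j"
      have "\<phi> ?a = \<phi> a"
        unfolding \<phi>_def by (rule A.finprod_cong') (auto simp: Z A.int_pow_mod_eq[OF Z Z_N])
      moreover have "\<chi> ?b = \<chi> b"
        unfolding \<chi>_def by (rule A.finprod_cong') (auto simp: X)
      ultimately show "\<phi> a \<otimes>\<^bsub>?A\<^esub> \<chi> b = \<psi> (?a, ?b)" by (simp add: \<psi>_def)
      show "(?a, ?b) \<in> carrier (?S \<times>\<times> ?L)"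
        using N by (auto simp: carrier_integer_mod_group)
    qed
    have \<phi>_0: "\<phi> (\<lambda>_. 0) = \<one>\<^bsub>?A\<^esub>" and \<chi>_0: "\<chi> (\<lambda>_. 0) = \<one>\<^bsub>?A\<^esub>"
      by (simp_all add: \<phi>_def \<chi>_def)
    have \<phi>_K: "\<phi> a \<in> ?K" and \<chi>_K: "\<chi> b \<in> ?K" for a b
      using image[of a "\<lambda>_. 0"] image[of "\<lambda>_. 0" b] by (simp_all add: \<phi>_0 \<chi>_0 \<phi>_closed \<chi>_closed)
    have single: "finprod ?A (\<lambda>j. f j [^]\<^bsub>?A\<^esub> (of_bool (j = k) :: int)) {..<m} = f k"
      if "k < m" "\<And>j. f j \<in> carrier ?A" for f and k m :: nat
    proof -
      have "finprod ?A (\<lambda>j. f j [^]\<^bsub>?A\<^esub> (of_bool (j = k) :: int)) {..<m} =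
          finprod ?A (\<lambda>j. if k = j then f j else \<one>\<^bsub>?A\<^esub>) {..<m}"
        using that by (intro A.finprod_cong') auto
      also have "\<dots> = f k"
        using that by (intro A.finprod_singleton) auto
      finally show ?thesis .
    qed
    have X_K: "X k \<in> ?K" if "k < d" for k
      using \<chi>_K[of "\<lambda>j. of_bool (j = k)"] single[OF that X] by (simp add: \<chi>_def)
    have Z_K: "Z k \<in> ?K" if "k < d" for k
    proof (cases "k < d - 1")
      case True
      then show ?thesis
        using \<phi>_K[of "\<lambda>j. of_bool (j = k)"] single[OF True Z] by (simp add: \<phi>_def)
    next
      case False
      \<comment> \<open>The last quotient \<open>Z (d - 1)\<close> is the inverse of the product of
        the others, which is \<open>\<phi>\<close> at the constant exponent 1. This exponent is not
        a reduced residue when \<open>N = 1\<close>; \<open>image\<close> allows for that.\<close>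
      then have "k = d - 1" "d = Suc k" using that by auto
      then have "Z k \<otimes>\<^bsub>?A\<^esub> finprod ?A Z {..<d - 1} = \<one>\<^bsub>?A\<^esub>"
        using Z_prod Z by (simp add: lessThan_Suc)
      moreover have "\<phi> (\<lambda>_. 1) = finprod ?A Z {..<d - 1}"
        unfolding \<phi>_def by (rule A.finprod_cong') (auto simp: Z)
      ultimately have "Z k = inv\<^bsub>?A\<^esub> \<phi> (\<lambda>_. 1)"
        using A.inv_equality[of "Z k" "\<phi> (\<lambda>_. 1)"] Z \<phi>_closed by simp
      then show ?thesis
        using K.m_inv_closed[OF \<phi>_K] by metis
    qed
    have "X i \<in> ?K" for i
    proof -
      have "i mod d < d" using d by simp
      then have "X (i mod d) \<otimes>\<^bsub>?A\<^esub> Z (i mod d) [^]\<^bsub>?A\<^esub> int (i div d) \<in> ?K"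
        using A.subgroup_int_pow_closed[OF K Z_K] X_K by (intro K.m_closed)
      then show ?thesis
        using X_pow[of "i mod d" "i div d"] by (simp only: int_pow_int mod_mult_div_eq mod_div_mult_eq)
    qed
    then show ?thesis
      by (intro fibonacci_ab_generated[OF n K]) (simp add: X_def)
  qed
  ultimately have "\<psi> \<in> iso (?S \<times>\<times> ?L) ?A"
    using \<psi>_hom by (simp add: iso_def bij_betw_def)
  then have "?S \<times>\<times> ?L \<cong> ?A" by (auto simp: is_iso_def)
  then show ?thesis by (rule group.iso_sym[OF T])
qed

end
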